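(* Let $H=L_2(\omega)$ be the finite-dimensional real Hilbert space of grid functions on a uniform rectangular grid $\omega$, with inner product $(\cdot,\cdot)$ and norm $\|\cdot\|$, let $E$ be the identity operator on $H$, and let $\delta>0$. Let $T>0$, let $N\ge1$ be an integer, and put $\tau=T/N$, $t^n=n\tau$. Let $D:H\to H$ be a linear operator with $D=D^*\ge0$. For $n=0,1,\dots,N-1$ let $C_0^n,R_+^n,R_-^n:H\to H$ be linear operators with $$(C_0^n)^*=-C_0^n,\qquad R_+^n=(R_+^n)^*,\quad 0\le R_+^n\le\delta E,\qquad R_-^n=(R_-^n)^*,\quad -\delta E\le R_-^n\le 0.$$ Let $y^0=u^0\in H$ be given, and consider the explicit-implicit difference scheme $$\frac{y^{n+1}-y^n}{\tau}+\left(C_0^n+D+R_+^n\right)y^{n+1}+R_-^n\,y^n=0,\qquad n=0,1,\dots,N-1.$$ Then this scheme is unconditionally $\varrho$-stable in $H$ with $\varrho=1+\delta\tau$: with no restriction on the time step $\tau>0$, its solutions satisfy $$\|y^{n+1}\|\le\varrho\,\|y^n\|,\qquad \varrho=1+\delta\tau,\qquad n=0,1,\dots,N-1.$$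
   Context: The grid is $\omega=\{(x_1,x_2): x_\alpha=(i_\alpha+\tfrac12)h_\alpha,\ i_\alpha=0,\dots,N_\alpha,\ (N_\alpha+1)h_\alpha=l_\alpha,\ \alpha=1,2\}$ in the rectangle $\Omega=(0,l_1)\times(0,l_2)$. The space $H=L_2(\omega)$ consists of real functions on $\omega$ with $(y,w)=\sum_{\bm x\in\omega}y(\bm x)w(\bm x)h_1h_2$ and $\|y\|=(y,y)^{1/2}$. For self-adjoint operators $S,Q$ on $H$, $S\le Q$ means $(Sy,y)\le(Qy,y)$ for all $y\in H$. The scheme approximates the convection-diffusion-reaction equation $\frac{dy}{dt}+(C_0+D+R)y=0$, $y(0)=u^0$. Here $D$ is the discrete diffusion operator (with Neumann boundary conditions), $C_0=C_0(t)$ is the discrete convection operator in symmetric form, which is skew-symmetric, and $R=R(t)$ is the reaction operator of multiplication by (the grid analogue of) $\frac12\operatorname{div}\bm v$, with $\bm v$ the velocity, so that $-\delta E\le R\le\delta E$. The reaction operator is split as $R=R_++R_-$ with $R_\pm$ as in the claim. The superscript $n$ denotes the value at time $t^n$. A scheme is called $\varrho$-stable in $H$ if its solutions (with homogeneous right-hand side) satisfy $\|y^{n+1}\|\le\varrho\|y^n\|$ at every time step, and unconditionally $\varrho$-stable if this holds for every time step $\tau>0$. *)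

theory Defs
  imports "HOL-Analysis.Analysis" "HOL-Library.Function_Algebras"
begin

(* The pointwise operations +, -, 0 of HOL-Library.Function_Algebras are used both for grid
   functions and for operators on them, so that (A + B) y = A y + B y and (- A) y = - (A y).
   The pointwise order on functions is not used; operators are compared by op_le below. *)

type_synonym gridfun = "real \<times> real \<Rightarrow> real"
type_synonym gridop = "gridfun \<Rightarrow> gridfun"

definition grid :: "real \<Rightarrow> real \<Rightarrow> nat \<Rightarrow> nat \<Rightarrow> (real \<times> real) set" where
  "grid h1 h2 N1 N2 =
     {((real i1 + 1/2) * h1, (real i2 + 1/2) * h2) | i1 i2. i1 \<le> N1 \<and> i2 \<le> N2}"

(* A real function on the finite set \<omega> is represented by its extension by zero, which makes the
   representation unique and closed under the pointwise operations. *)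
definition grid_space :: "(real \<times> real) set \<Rightarrow> gridfun set" where
  "grid_space \<omega> = {y. \<forall>x. x \<notin> \<omega> \<longrightarrow> y x = 0}"

definition grid_scale :: "real \<Rightarrow> gridfun \<Rightarrow> gridfun" where
  "grid_scale c y = (\<lambda>x. c * y x)"

definition grid_inner ::
    "(real \<times> real) set \<Rightarrow> real \<Rightarrow> real \<Rightarrow> gridfun \<Rightarrow> gridfun \<Rightarrow> real" where
  "grid_inner \<omega> h1 h2 y w = (\<Sum>x\<in>\<omega>. y x * w x * h1 * h2)"

definition grid_norm :: "(real \<times> real) set \<Rightarrow> real \<Rightarrow> real \<Rightarrow> gridfun \<Rightarrow> real" where
  "grid_norm \<omega> h1 h2 y = sqrt (grid_inner \<omega> h1 h2 y y)"

(* Linear operators from the grid space to itself; values outside the grid space are irrelevant. *)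
definition linear_op :: "(real \<times> real) set \<Rightarrow> gridop \<Rightarrow> bool" where
  "linear_op \<omega> A \<longleftrightarrow>
     (\<forall>y\<in>grid_space \<omega>. A y \<in> grid_space \<omega>) \<and>
     (\<forall>y\<in>grid_space \<omega>. \<forall>w\<in>grid_space \<omega>. A (y + w) = A y + A w) \<and>
     (\<forall>c. \<forall>y\<in>grid_space \<omega>. A (grid_scale c y) = grid_scale c (A y))"

(* For linear A and B this says that B is the adjoint of A. *)
definition is_adjoint ::
    "(real \<times> real) set \<Rightarrow> real \<Rightarrow> real \<Rightarrow> gridop \<Rightarrow> gridop \<Rightarrow> bool" where
  "is_adjoint \<omega> h1 h2 A B \<longleftrightarrow>
     (\<forall>y\<in>grid_space \<omega>. \<forall>w\<in>grid_space \<omega>.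
        grid_inner \<omega> h1 h2 (A y) w = grid_inner \<omega> h1 h2 y (B w))"

definition op_le ::
    "(real \<times> real) set \<Rightarrow> real \<Rightarrow> real \<Rightarrow> gridop \<Rightarrow> gridop \<Rightarrow> bool" where
  "op_le \<omega> h1 h2 S Q \<longleftrightarrow>
     (\<forall>y\<in>grid_space \<omega>. grid_inner \<omega> h1 h2 (S y) y \<le> grid_inner \<omega> h1 h2 (Q y) y)"

(* Solutions y 0, ..., y N of the explicit-implicit scheme with zero right-hand side and initial
   value u0. The operator grid_scale c is c times the identity. *)
definition expl_impl_solution ::
    "(real \<times> real) set \<Rightarrow> real \<Rightarrow> nat \<Rightarrow> (nat \<Rightarrow> gridop) \<Rightarrow> gridop \<Rightarrow>
     (nat \<Rightarrow> gridop) \<Rightarrow> (nat \<Rightarrow> gridop) \<Rightarrow> gridfun \<Rightarrow> (nat \<Rightarrow> gridfun) \<Rightarrow> bool" where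
  "expl_impl_solution \<omega> \<tau> N C0 D Rp Rm u0 y \<longleftrightarrow>
     (\<forall>n\<le>N. y n \<in> grid_space \<omega>) \<and> y 0 = u0 \<and>
     (\<forall>n<N. grid_scale (1 / \<tau>) (y (n + 1) - y n)
             + (C0 n + D + Rp n) (y (n + 1)) + Rm n (y n) = 0)"

(* A scheme with N time steps is given by its solution relation: sol u0 y means that the
   sequence y solves the homogeneous scheme with initial value u0. *)
definition rho_stable ::
    "(real \<times> real) set \<Rightarrow> real \<Rightarrow> real \<Rightarrow> nat \<Rightarrow>
     (gridfun \<Rightarrow> (nat \<Rightarrow> gridfun) \<Rightarrow> bool) \<Rightarrow> real \<Rightarrow> bool" where
  "rho_stable \<omega> h1 h2 N sol \<rho> \<longleftrightarrow>
     (\<forall>u0\<in>grid_space \<omega>. \<forall>y. sol u0 y \<longrightarrow>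
        (\<forall>n<N. grid_norm \<omega> h1 h2 (y (n + 1)) \<le> \<rho> * grid_norm \<omega> h1 h2 (y n)))"

end

theory Submission
  imports Defs
begin

text \<open>
  Take the inner product of one step of the scheme with the new value v. Skew-symmetry of the
  convection operator and nonnegativity of the implicit operators leave
  (v, v) \<open>\<le>\<close> (S u, v), where u is the old value and S = E - \<open>\<tau>\<close> R_- is self-adjoint with
  0 \<open>\<le>\<close> S \<open>\<le>\<close> \<open>\<rho>\<close> E. By polarization at \<open>\<rho>\<close> u and v,
  4 \<open>\<rho>\<close> (v, v) \<open>\<le>\<close> 4 (S (\<open>\<rho>\<close> u), v) \<open>\<le>\<close> \<open>\<rho>\<close> (\<open>\<rho>\<close> u + v, \<open>\<rho>\<close> u + v) and the last inner product is at most
  2 (\<open>\<rho>\<close> u, \<open>\<rho>\<close> u) + 2 (v, v), so that (v, v) \<open>\<le>\<close> (\<open>\<rho>\<close> u, \<open>\<rho>\<close> u).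
\<close>

lemma grid_inner_commute: "grid_inner \<omega> h1 h2 y w = grid_inner \<omega> h1 h2 w y"
  by (simp add: grid_inner_def mult.commute)

lemma grid_inner_add_left:
  "grid_inner \<omega> h1 h2 (y + z) w = grid_inner \<omega> h1 h2 y w + grid_inner \<omega> h1 h2 z w"
  by (simp add: grid_inner_def sum.distrib ring_distribs)

lemma grid_inner_add_right:
  "grid_inner \<omega> h1 h2 w (y + z) = grid_inner \<omega> h1 h2 w y + grid_inner \<omega> h1 h2 w z"
  by (simp add: grid_inner_def sum.distrib ring_distribs)

lemma grid_inner_diff_left:
  "grid_inner \<omega> h1 h2 (y - z) w = grid_inner \<omega> h1 h2 y w - grid_inner \<omega> h1 h2 z w"
  by (simp add: grid_inner_def sum_subtractf ring_distribs)

lemma grid_inner_minus_right: "grid_inner \<omega> h1 h2 w (- y) = - grid_inner \<omega> h1 h2 w y"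
  by (simp add: grid_inner_def sum_negf)

lemma grid_inner_scale_left:
  "grid_inner \<omega> h1 h2 (grid_scale c y) w = c * grid_inner \<omega> h1 h2 y w"
  by (simp add: grid_inner_def grid_scale_def sum_distrib_left ac_simps)

lemma grid_inner_scale_right:
  "grid_inner \<omega> h1 h2 w (grid_scale c y) = c * grid_inner \<omega> h1 h2 w y"
  by (simp add: grid_inner_commute [of _ _ _ w] grid_inner_scale_left)

lemma grid_inner_zero_left: "grid_inner \<omega> h1 h2 0 w = 0"
  by (simp add: grid_inner_def)

lemmas grid_inner_simps =
  grid_inner_add_left grid_inner_add_right grid_inner_diff_left grid_inner_minus_right
  grid_inner_scale_left grid_inner_scale_right grid_inner_zero_left

lemma grid_inner_nonneg:
  assumes "h1 \<ge> 0" "h2 \<ge> 0"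
  shows "grid_inner \<omega> h1 h2 y y \<ge> 0"
  unfolding grid_inner_def using assms by (intro sum_nonneg) simp

lemma grid_space_add: "y \<in> grid_space \<omega> \<Longrightarrow> w \<in> grid_space \<omega> \<Longrightarrow> y + w \<in> grid_space \<omega>"
  by (simp add: grid_space_def)

lemma grid_space_scale: "y \<in> grid_space \<omega> \<Longrightarrow> grid_scale c y \<in> grid_space \<omega>"
  by (simp add: grid_space_def grid_scale_def)

text \<open>Moving \<open>A\<close> across flips the sign, while symmetry of the inner product
  restores the same value. This removes convection from the energy balance.\<close>

lemma grid_inner_skew_eq_0:
  assumes "is_adjoint \<omega> h1 h2 A (- A)" "y \<in> grid_space \<omega>"
  shows "grid_inner \<omega> h1 h2 (A y) y = 0"
proof -
  have "grid_inner \<omega> h1 h2 (A y) y = - grid_inner \<omega> h1 h2 y (A y)"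
    using assms by (simp add: is_adjoint_def grid_inner_minus_right)
  then show ?thesis
    using grid_inner_commute [of \<omega> h1 h2 "A y" y] by simp
qed

text \<open>In the difference of the two quadratic forms the diagonal terms cancel and the four
  mixed terms agree by self-adjointness. The difference \<open>d\<close> is written as a sum with a
  multiple because \<open>linear_op\<close> speaks of sums and multiples.\<close>

lemma self_adjoint_polarization:
  assumes "linear_op \<omega> A" "is_adjoint \<omega> h1 h2 A A"
    and w: "w \<in> grid_space \<omega>" and v: "v \<in> grid_space \<omega>"
  defines "d \<equiv> w + grid_scale (- 1) v"
  shows "4 * grid_inner \<omega> h1 h2 (A w) v =
    grid_inner \<omega> h1 h2 (A (w + v)) (w + v) - grid_inner \<omega> h1 h2 (A d) d"
proof -
  have "A (w + v) = A w + A v" "A d = A w + grid_scale (- 1) (A v)"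
    using assms by (auto simp: linear_op_def d_def grid_space_scale)
  moreover have "grid_inner \<omega> h1 h2 (A v) w = grid_inner \<omega> h1 h2 (A w) v"
    using assms by (simp add: is_adjoint_def grid_inner_commute [of _ _ _ w])
  ultimately show ?thesis
    by (simp add: d_def grid_inner_simps algebra_simps)
qed

text \<open>After polarization the lower bound on \<open>A\<close> is used at \<open>w + v\<close>,
  and the term at the difference is dropped since \<open>A\<close> is nonpositive there.\<close>

lemma self_adjoint_cross_bound:
  assumes "linear_op \<omega> A" "is_adjoint \<omega> h1 h2 A A"
    and lower: "op_le \<omega> h1 h2 (grid_scale (- \<delta>)) A" and upper: "op_le \<omega> h1 h2 A 0"
    and w: "w \<in> grid_space \<omega>" and v: "v \<in> grid_space \<omega>"
  shows "- 4 * grid_inner \<omega> h1 h2 (A w) v \<le> \<delta> * grid_inner \<omega> h1 h2 (w + v) (w + v)"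
proof -
  have "- \<delta> * grid_inner \<omega> h1 h2 (w + v) (w + v) \<le> grid_inner \<omega> h1 h2 (A (w + v)) (w + v)"
    using lower grid_space_add [OF w v] unfolding op_le_def grid_inner_scale_left by blast
  moreover have "grid_inner \<omega> h1 h2 (A d) d \<le> 0" if "d \<in> grid_space \<omega>" for d
    using upper that by (simp add: op_le_def grid_inner_zero_left)
  ultimately show ?thesis
    using self_adjoint_polarization [OF assms(1,2) w v]
      grid_space_add [OF w grid_space_scale [OF v, of "- 1"]]
    by fastforce
qed

lemma expl_impl_step_bound:
  assumes "h1 \<ge> 0" "h2 \<ge> 0" "\<tau> > 0" "\<delta> \<ge> 0"
    and u: "u \<in> grid_space \<omega>" and v: "v \<in> grid_space \<omega>"
    and step: "grid_scale (1 / \<tau>) (v - u) + (C + D + P) v + A u = 0"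
    and C: "is_adjoint \<omega> h1 h2 C (- C)"
    and D: "op_le \<omega> h1 h2 0 D" and P: "op_le \<omega> h1 h2 0 P"
    and A: "linear_op \<omega> A" "is_adjoint \<omega> h1 h2 A A"
      "op_le \<omega> h1 h2 (grid_scale (- \<delta>)) A" "op_le \<omega> h1 h2 A 0"
  shows "grid_norm \<omega> h1 h2 v \<le> (1 + \<delta> * \<tau>) * grid_norm \<omega> h1 h2 u"
proof -
  let ?ip = "grid_inner \<omega> h1 h2"
  define \<rho> where "\<rho> = 1 + \<delta> * \<tau>"
  \<comment> \<open>With \<open>u\<close> scaled by the expected growth factor, the goal becomes (v,
    v) \<le> (w, w), where both vectors enter alike.\<close>
  define w where "w = grid_scale \<rho> u"
  have \<rho>: "\<rho> > 0"
    using assms by (simp add: \<rho>_def add_pos_nonneg)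
  have w: "w \<in> grid_space \<omega>"
    by (simp add: w_def grid_space_scale u)
  have "?ip (grid_scale (1 / \<tau>) (v - u) + (C + D + P) v + A u) v = 0"
    unfolding step by (rule grid_inner_zero_left)
  then have "(?ip v v - ?ip u v) / \<tau> + ?ip (C v) v + ?ip (D v) v + ?ip (P v) v + ?ip (A u) v = 0"
    by (simp add: grid_inner_simps)
  moreover have "?ip (C v) v = 0"
    using grid_inner_skew_eq_0 [OF C v] .
  moreover have "?ip (D v) v \<ge> 0" "?ip (P v) v \<ge> 0"
    using D P v by (simp_all add: op_le_def grid_inner_zero_left)
  ultimately have "(?ip v v - ?ip u v) / \<tau> \<le> - ?ip (A u) v"
    by linarith
  then have "?ip v v \<le> ?ip u v - \<tau> * ?ip (A u) v"
    using \<open>\<tau> > 0\<close> by (simp add: field_simps)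
  then have "\<rho> * ?ip v v \<le> \<rho> * (?ip u v - \<tau> * ?ip (A u) v)"
    using \<rho> by (intro mult_left_mono) auto
  also have "\<dots> = ?ip w v - \<tau> * ?ip (A w) v"
    using A(1) u by (simp add: w_def linear_op_def grid_inner_simps algebra_simps)
  finally have energy: "\<rho> * ?ip v v \<le> ?ip w v - \<tau> * ?ip (A w) v" .
  \<comment> \<open>The expanded square of w - v. It serves twice: for 4 (w, v) \<le> (w + v, w +
    v), and for (w + v, w + v) \<le> 2 (w, w) + 2 (v, v).\<close>
  have diff: "?ip w w - 2 * ?ip w v + ?ip v v \<ge> 0"
    using grid_inner_nonneg [OF assms(1,2), of \<omega> "w + grid_scale (- 1) v"]
    by (simp add: grid_inner_simps grid_inner_commute [of _ _ _ v w])
  have sum: "?ip (w + v) (w + v) = ?ip w w + 2 * ?ip w v + ?ip v v"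
    by (simp add: grid_inner_simps grid_inner_commute [of _ _ _ v w])
  have "\<tau> * (- 4 * ?ip (A w) v) \<le> \<tau> * (\<delta> * ?ip (w + v) (w + v))"
    using self_adjoint_cross_bound [OF A w v] \<open>\<tau> > 0\<close> by (intro mult_left_mono) auto
  \<comment> \<open>The identity part of S contributes the factor 1 and the part with
    \<open>A\<close> the factor \<open>\<delta> * \<tau>\<close>; together they make
    \<open>\<rho>\<close>.\<close>
  with energy diff have "4 * (\<rho> * ?ip v v) \<le> \<rho> * ?ip (w + v) (w + v)"
    unfolding \<rho>_def sum by (simp add: algebra_simps)
  also have "\<dots> \<le> \<rho> * (2 * ?ip w w + 2 * ?ip v v)"
    using \<rho> diff unfolding sum by (intro mult_left_mono) auto
  finally have "\<rho> * (?ip v v) \<le> \<rho> * ?ip w w"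
    by (simp add: algebra_simps)
  then have "?ip v v \<le> ?ip w w"
    using \<rho> by simp
  also have "?ip w w = \<rho>\<^sup>2 * ?ip u u"
    by (simp add: w_def grid_inner_simps power2_eq_square)
  finally have "sqrt (?ip v v) \<le> sqrt (\<rho>\<^sup>2 * ?ip u u)"
    by simp
  then show ?thesis
    using \<rho> by (simp add: grid_norm_def real_sqrt_mult \<rho>_def)
qed

theorem theorem2:
  fixes l1 l2 h1 h2 \<delta> T \<tau> :: real
    and N1 N2 N :: nat
    and \<omega> :: "(real \<times> real) set"
    and D :: gridop
    and C0 Rp Rm :: "nat \<Rightarrow> gridop"
  assumes "l1 > 0" and "l2 > 0"
    and "(real N1 + 1) * h1 = l1" and "(real N2 + 1) * h2 = l2"
    and "\<omega> = grid h1 h2 N1 N2"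
    and "\<delta> > 0"
    and "T > 0" and "N \<ge> 1" and "\<tau> = T / real N"
    and "linear_op \<omega> D" and "is_adjoint \<omega> h1 h2 D D" and "op_le \<omega> h1 h2 0 D"
    and "\<And>n. n < N \<Longrightarrow> linear_op \<omega> (C0 n)"
    and "\<And>n. n < N \<Longrightarrow> is_adjoint \<omega> h1 h2 (C0 n) (- C0 n)"
    and "\<And>n. n < N \<Longrightarrow> linear_op \<omega> (Rp n)"
    and "\<And>n. n < N \<Longrightarrow> is_adjoint \<omega> h1 h2 (Rp n) (Rp n)"
    and "\<And>n. n < N \<Longrightarrow> op_le \<omega> h1 h2 0 (Rp n)"
    and "\<And>n. n < N \<Longrightarrow> op_le \<omega> h1 h2 (Rp n) (grid_scale \<delta>)"
    and "\<And>n. n < N \<Longrightarrow> linear_op \<omega> (Rm n)"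
    and "\<And>n. n < N \<Longrightarrow> is_adjoint \<omega> h1 h2 (Rm n) (Rm n)"
    and "\<And>n. n < N \<Longrightarrow> op_le \<omega> h1 h2 (grid_scale (- \<delta>)) (Rm n)"
    and "\<And>n. n < N \<Longrightarrow> op_le \<omega> h1 h2 (Rm n) 0"
  shows "rho_stable \<omega> h1 h2 N (expl_impl_solution \<omega> \<tau> N C0 D Rp Rm) (1 + \<delta> * \<tau>)"
proof -
  \<comment> \<open>Positive side lengths force positive mesh sizes, so the weights of the inner
    product are nonnegative.\<close>
  have h: "h1 \<ge> 0" "h2 \<ge> 0"
    using assms(1-4) by (auto simp: zero_less_mult_iff)
  have \<tau>: "\<tau> > 0"
    using assms(7-9) by simp
  show ?thesis
    unfolding rho_stable_def expl_impl_solution_def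
  proof (intro ballI allI impI)
    fix u0 y n
    assume y: "(\<forall>n\<le>N. y n \<in> grid_space \<omega>) \<and> y 0 = u0 \<and>
      (\<forall>n<N. grid_scale (1 / \<tau>) (y (n + 1) - y n)
        + (C0 n + D + Rp n) (y (n + 1)) + Rm n (y n) = 0)" and n: "n < N"
    have step: "grid_scale (1 / \<tau>) (y (n + 1) - y n)
        + (C0 n + D + Rp n) (y (n + 1)) + Rm n (y n) = 0"
      using y n by blast
    \<comment> \<open>From \<open>n < N\<close> also \<open>n + 1 \<le> N\<close>, so both ends of
      the step are covered.\<close>
    have "y n \<in> grid_space \<omega>" "y (n + 1) \<in> grid_space \<omega>"
      using y n by auto
    then show "grid_norm \<omega> h1 h2 (y (n + 1)) \<le> (1 + \<delta> * \<tau>) * grid_norm \<omega> h1 h2 (y n)"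
      using step
      by (rule expl_impl_step_bound [OF h \<tau> less_imp_le [OF \<open>\<delta> > 0\<close>]])
        (use n assms(12,14,17,19-22) in auto)
  qed
qed

end
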